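(* Let $\mathcal{L}\in\mathcal{M}(N)$, $\mathcal{T}\in\mathcal{A}(N)$, let $\mathbb{A}$ abstract $(\mathcal{L},\mathcal{T})$, let $(\mathcal{T},\mathbb{A})\models\mathsf{AxCmpl}$, and suppose $\mathbb{A}$ is finitary. For all states $p,q$ of $\mathcal{L}$, $p\sqsubseteq_{\mathcal{T}}q$ implies $p\sqsubseteq_{\mathbb{A}}q$.
   Context: $\mathsf{Act}$ countable set of visible actions, $\tau\notin\mathsf{Act}$, $\mathsf{L}=\mathsf{Act}\cup\{\tau\}$, involutive duality $\mu\mapsto\overline{\mu}$; $N\subseteq\mathsf{Act}$ non-blocking, $B=\mathsf{Act}\setminus N$; LTSs finite-image. Axioms (all $\alpha\in\mathsf{L}$, $\eta\in N$, $\mu\in\mathsf{Act}$, $\mu\ne\eta$): N-delay: $p_1\xrightarrow{\eta}p_2\xrightarrow{\alpha}p_3\Rightarrow\exists p_4.\,p_1\xrightarrow{\alpha}p_4\xrightarrow{\eta}p_3$; N-confluence: $p_1\xrightarrow{\eta}p_2,p_1\xrightarrow{\mu}p_3\Rightarrow\exists p_4.\,p_2\xrightarrow{\mu}p_4,p_3\xrightarrow{\eta}p_4$; N-determinacy: $p_1\xrightarrow{\eta}p_2,p_1\xrightarrow{\eta}p_3\Rightarrow p_2=p_3$; backwards-N-determinacy: $p_2\xrightarrow{\eta}p_1,p_3\xrightarrow{\eta}p_1\Rightarrow p_2=p_3$; Fwd-Feedback: $p_1\xrightarrow{\eta}p_2\xrightarrow{\overline{\eta}}p_3\Rightarrow p_1\xrightarrow{\tau}p_3$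 or $p_1=p_3$; Boomerang: each $p$ has $p'$ with $p\xrightarrow{\overline{\eta}}p'\xrightarrow{\eta}p$; N-tau: $p_1\xrightarrow{\eta}p_2,p_1\xrightarrow{\tau}p_3$ imply $\exists p_4.\,p_2\xrightarrow{\tau}p_4,p_3\xrightarrow{\eta}p_4$, or $p_2\xrightarrow{\overline{\eta}}p_3$; Feedback: $p\xrightarrow{\eta}q\xrightarrow{\overline{\eta}}q'\Rightarrow p\xrightarrow{\tau}q'$. $\mathcal{M}(N)$: LTSs with N-delay, N-confluence, N-determinacy, backwards-N-determinacy, Fwd-Feedback, Boomerang, N-tau. $\mathcal{A}(N)$: LTSs with N-delay, N-confluence, N-determinacy, backwards-N-determinacy, N-tau, Feedback. Composition of $p$ and test $t$: steps by $\tau$-moves of either side or by $p\xrightarrow{\overline{\mu}}p'$, $t\xrightarrow{\mu}t'$. good: decidable predicate on tests preserved in both directions by $N$-transitions. Must$(p,t)$ iff every maximal computation from $(p,t)$ contains a state with good test; $p\sqsubseteq_{\mathcal{T}}q$ iff for all tests $t$, Must$(p,t)\Rightarrow$Must$(q,t)$. $p\Downarrow s$: no state reached via a weak transition along a prefix of $s$ has an infinite $\tau$-sequence. $\mathrm{ws}(p,s)=\{q:p\overset{s}{\Rightarrow}q\not\xrightarrow{\tau}\}$. $R(t)=\{\mu:t\xrightarrow{\mu}\}$, $\mathrm{coR}(p)=\{\beta\in B:p\xrightarrow{\overline{\beta}}\}$. Label abstraction $\mathbb{A}=(\phi:B\to Y,\delta:Y\to X)$, $\mathrm{coR}_{\mathbb{A}}(p)=\{\delta(\phi(\beta)):\beta\in\mathrm{coR}(p)\}$;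 finitary if all $\mathrm{coR}_{\mathbb{A}}(p)$ are finite; abstracts $(\mathcal{L},\mathcal{T})$ if for all $\beta,\beta'\in B$: (i) for each test $t$, $\phi(\beta)=\phi(\beta')$, $\beta\in R(t)\Rightarrow\beta'\in R(t)$; (ii) for each $p$ in $\mathcal{L}$, $\delta(\phi(\beta))=\delta(\phi(\beta'))$, $\phi(\beta)\in\phi(\mathrm{coR}(p))\Rightarrow\phi(\beta')\in\phi(\mathrm{coR}(p))$. $[\![p]\!](s)=\{\mathrm{coR}_{\mathbb{A}}(q):q\in\mathrm{ws}(p,s)\}$; $\mathcal{A}\ll\mathcal{B}$ iff each $x\in\mathcal{B}$ has $y\in\mathcal{A}$ with $y\subseteq x$; $p\sqsubseteq_{\mathbb{A}}q$ iff for all $s\in\mathsf{Act}^*$, $p\Downarrow s$ implies $q\Downarrow s$ and $[\![p]\!](s)\ll[\![q]\!](s)$. $(\mathcal{T},\mathbb{A})\models\mathsf{AxCmpl}$: there are $t_{cnv}:\mathsf{Act}^*\to T$, $t_{acc}:\mathsf{Act}^*\times\mathcal{P}_{fin}(X)\to T$ such that for all $s$, $\mu,\mu'\in\mathsf{Act}$, finite $E\subseteq X$, $f\in\{t_{cnv},t_{acc}(\cdot,E)\}$: (1) not good$(f(s))$; (2) $f(\mu.s)\xrightarrow{\mu}f(s)$; (3) $\mu\in B\Rightarrow f(\mu.s)\xrightarrow{\tau}$; (4) $\mu\in B$, $f(\mu.s)\xrightarrow{\tau}t\Rightarrow$ good$(t)$; (5) $\mu\in B$, $f(\mu.s)\xrightarrow{\mu}t\Rightarrow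 t=f(s)$; (6) $\mu\in B$, $f(\mu.s)\xrightarrow{\mu'}t$, $\mu'\ne\mu\Rightarrow$ good$(t)$; (a1) $t_{acc}(\varepsilon,E)\not\xrightarrow{\tau}$; (a2) $t_{acc}(\varepsilon,E)\not\xrightarrow{\eta}$, $\eta\in N$; (a3) $\beta\in B$, $t_{acc}(\varepsilon,E)\xrightarrow{\beta}\Rightarrow\delta(\phi(\beta))\in E$; (a4) each $e\in E$ is $\delta(\phi(\beta))$ for some $\beta\in B$ with $t_{acc}(\varepsilon,E)\xrightarrow{\beta}$; (a5) $\beta\in B$, $t_{acc}(\varepsilon,E)\xrightarrow{\beta}t\Rightarrow$ good$(t)$; (c1) $t_{cnv}(\varepsilon)\not\xrightarrow{\mu}$, $\mu\in\mathsf{Act}$; (c2) $t_{cnv}(\varepsilon)\xrightarrow{\tau}$; (c3) $t_{cnv}(\varepsilon)\xrightarrow{\tau}t\Rightarrow$ good$(t)$. *)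

theory Defs
  imports "HOL-Library.Countable" "HOL-Library.FuncSet" "HOL-Library.Sublist"
begin

datatype 'a label = Tau | Vis 'a

type_synonym ('s, 'a) lts = "'s \<Rightarrow> 'a label \<Rightarrow> 's \<Rightarrow> bool"

definition involutive :: "('a \<Rightarrow> 'a) \<Rightarrow> bool" where
  "involutive dual \<longleftrightarrow> (\<forall>\<mu>. dual (dual \<mu>) = \<mu>)"

definition enabled :: "('s, 'a) lts \<Rightarrow> 's \<Rightarrow> 'a label \<Rightarrow> bool" where
  "enabled R p \<alpha> \<longleftrightarrow> (\<exists>p'. R p \<alpha> p')"

definition finite_image :: "('s, 'a) lts \<Rightarrow> bool" where
  "finite_image R \<longleftrightarrow> (\<forall>p \<alpha>. finite {p'. R p \<alpha> p'})"

subsection \<open>Axioms on labelled transition systems\<close>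

text \<open>\<open>N\<close> is the set of non-blocking actions; the blocking actions are its complement \<open>- N\<close>.\<close>

definition N_delay :: "'a set \<Rightarrow> ('s, 'a) lts \<Rightarrow> bool" where
  "N_delay N R \<longleftrightarrow> (\<forall>\<eta>\<in>N. \<forall>\<alpha> p1 p2 p3. R p1 (Vis \<eta>) p2 \<longrightarrow> R p2 \<alpha> p3 \<longrightarrow>
     (\<exists>p4. R p1 \<alpha> p4 \<and> R p4 (Vis \<eta>) p3))"

definition N_confluence :: "'a set \<Rightarrow> ('s, 'a) lts \<Rightarrow> bool" where
  "N_confluence N R \<longleftrightarrow> (\<forall>\<eta>\<in>N. \<forall>\<mu> p1 p2 p3. \<mu> \<noteq> \<eta> \<longrightarrow> R p1 (Vis \<eta>) p2 \<longrightarrow> R p1 (Vis \<mu>) p3 \<longrightarrow>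
     (\<exists>p4. R p2 (Vis \<mu>) p4 \<and> R p3 (Vis \<eta>) p4))"

definition N_determinacy :: "'a set \<Rightarrow> ('s, 'a) lts \<Rightarrow> bool" where
  "N_determinacy N R \<longleftrightarrow>
     (\<forall>\<eta>\<in>N. \<forall>p1 p2 p3. R p1 (Vis \<eta>) p2 \<longrightarrow> R p1 (Vis \<eta>) p3 \<longrightarrow> p2 = p3)"

definition backwards_N_determinacy :: "'a set \<Rightarrow> ('s, 'a) lts \<Rightarrow> bool" where
  "backwards_N_determinacy N R \<longleftrightarrow>
     (\<forall>\<eta>\<in>N. \<forall>p1 p2 p3. R p2 (Vis \<eta>) p1 \<longrightarrow> R p3 (Vis \<eta>) p1 \<longrightarrow> p2 = p3)"

definition Fwd_Feedback :: "('a \<Rightarrow> 'a) \<Rightarrow> 'a set \<Rightarrow> ('s, 'a) lts \<Rightarrow> bool" where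
  "Fwd_Feedback dual N R \<longleftrightarrow>
     (\<forall>\<eta>\<in>N. \<forall>p1 p2 p3. R p1 (Vis \<eta>) p2 \<longrightarrow> R p2 (Vis (dual \<eta>)) p3 \<longrightarrow> R p1 Tau p3 \<or> p1 = p3)"

definition Boomerang :: "('a \<Rightarrow> 'a) \<Rightarrow> 'a set \<Rightarrow> ('s, 'a) lts \<Rightarrow> bool" where
  "Boomerang dual N R \<longleftrightarrow> (\<forall>\<eta>\<in>N. \<forall>p. \<exists>p'. R p (Vis (dual \<eta>)) p' \<and> R p' (Vis \<eta>) p)"

definition N_tau :: "('a \<Rightarrow> 'a) \<Rightarrow> 'a set \<Rightarrow> ('s, 'a) lts \<Rightarrow> bool" where
  "N_tau dual N R \<longleftrightarrow> (\<forall>\<eta>\<in>N. \<forall>p1 p2 p3. R p1 (Vis \<eta>) p2 \<longrightarrow> R p1 Tau p3 \<longrightarrow>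
     (\<exists>p4. R p2 Tau p4 \<and> R p3 (Vis \<eta>) p4) \<or> R p2 (Vis (dual \<eta>)) p3)"

definition Feedback :: "('a \<Rightarrow> 'a) \<Rightarrow> 'a set \<Rightarrow> ('s, 'a) lts \<Rightarrow> bool" where
  "Feedback dual N R \<longleftrightarrow>
     (\<forall>\<eta>\<in>N. \<forall>p q q'. R p (Vis \<eta>) q \<longrightarrow> R q (Vis (dual \<eta>)) q' \<longrightarrow> R p Tau q')"

definition in_M :: "('a \<Rightarrow> 'a) \<Rightarrow> 'a set \<Rightarrow> ('s, 'a) lts \<Rightarrow> bool" where
  "in_M dual N R \<longleftrightarrow> N_delay N R \<and> N_confluence N R \<and> N_determinacy N R \<and>
     backwards_N_determinacy N R \<and> Fwd_Feedback dual N R \<and> Boomerang dual N R \<and> N_tau dual N R"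

definition in_A :: "('a \<Rightarrow> 'a) \<Rightarrow> 'a set \<Rightarrow> ('s, 'a) lts \<Rightarrow> bool" where
  "in_A dual N R \<longleftrightarrow> N_delay N R \<and> N_confluence N R \<and> N_determinacy N R \<and>
     backwards_N_determinacy N R \<and> N_tau dual N R \<and> Feedback dual N R"

subsection \<open>Must-testing\<close>

inductive comp_step ::
    "('a \<Rightarrow> 'a) \<Rightarrow> ('p, 'a) lts \<Rightarrow> ('t, 'a) lts \<Rightarrow> 'p \<times> 't \<Rightarrow> 'p \<times> 't \<Rightarrow> bool"
  for dual :: "'a \<Rightarrow> 'a" and L :: "('p, 'a) lts" and T :: "('t, 'a) lts" where
  proc_tau: "L p Tau p' \<Longrightarrow> comp_step dual L T (p, t) (p', t)"
| test_tau: "T t Tau t' \<Longrightarrow> comp_step dual L T (p, t) (p, t')"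
| comm: "L p (Vis (dual \<mu>)) p' \<Longrightarrow> T t (Vis \<mu>) t' \<Longrightarrow> comp_step dual L T (p, t) (p', t')"

definition finite_maximal_computation :: "('s \<Rightarrow> 's \<Rightarrow> bool) \<Rightarrow> 's \<Rightarrow> 's list \<Rightarrow> bool" where
  "finite_maximal_computation step x xs \<longleftrightarrow>
     xs \<noteq> [] \<and> hd xs = x \<and> successively step xs \<and> (\<nexists>y. step (last xs) y)"

definition infinite_computation :: "('s \<Rightarrow> 's \<Rightarrow> bool) \<Rightarrow> 's \<Rightarrow> (nat \<Rightarrow> 's) \<Rightarrow> bool" where
  "infinite_computation step x c \<longleftrightarrow> c 0 = x \<and> (\<forall>i. step (c i) (c (Suc i)))"

text \<open>A maximal computation is either infinite or finite with a stuck last state.\<close>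

definition Must ::
    "('a \<Rightarrow> 'a) \<Rightarrow> ('p, 'a) lts \<Rightarrow> ('t, 'a) lts \<Rightarrow> ('t \<Rightarrow> bool) \<Rightarrow> 'p \<Rightarrow> 't \<Rightarrow> bool" where
  "Must dual L T good p t \<longleftrightarrow>
     (\<forall>xs. finite_maximal_computation (comp_step dual L T) (p, t) xs \<longrightarrow> (\<exists>x\<in>set xs. good (snd x))) \<and>
     (\<forall>c. infinite_computation (comp_step dual L T) (p, t) c \<longrightarrow> (\<exists>i. good (snd (c i))))"

definition must_preorder ::
    "('a \<Rightarrow> 'a) \<Rightarrow> ('p, 'a) lts \<Rightarrow> ('t, 'a) lts \<Rightarrow> ('t \<Rightarrow> bool) \<Rightarrow> 'p \<Rightarrow> 'p \<Rightarrow> bool" where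
  "must_preorder dual L T good p q \<longleftrightarrow>
     (\<forall>t. Must dual L T good p t \<longrightarrow> Must dual L T good q t)"

definition good_N_invariant :: "'a set \<Rightarrow> ('t, 'a) lts \<Rightarrow> ('t \<Rightarrow> bool) \<Rightarrow> bool" where
  "good_N_invariant N T good \<longleftrightarrow> (\<forall>\<eta>\<in>N. \<forall>t t'. T t (Vis \<eta>) t' \<longrightarrow> (good t \<longleftrightarrow> good t'))"

subsection \<open>Weak transitions, convergence and label abstractions\<close>

inductive weak :: "('s, 'a) lts \<Rightarrow> 's \<Rightarrow> 'a list \<Rightarrow> 's \<Rightarrow> bool"
  for R :: "('s, 'a) lts" where
  weak_refl: "weak R p [] p"
| weak_tau: "R p Tau p' \<Longrightarrow> weak R p' s q \<Longrightarrow> weak R p s q"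
| weak_vis: "R p (Vis \<mu>) p' \<Longrightarrow> weak R p' s q \<Longrightarrow> weak R p (\<mu> # s) q"

definition diverges :: "('s, 'a) lts \<Rightarrow> 's \<Rightarrow> bool" where
  "diverges R p \<longleftrightarrow> (\<exists>c. infinite_computation (\<lambda>x y. R x Tau y) p c)"

definition converges_along :: "('s, 'a) lts \<Rightarrow> 's \<Rightarrow> 'a list \<Rightarrow> bool" where
  "converges_along R p s \<longleftrightarrow> (\<forall>s' q. prefix s' s \<longrightarrow> weak R p s' q \<longrightarrow> \<not> diverges R q)"

definition ws :: "('s, 'a) lts \<Rightarrow> 's \<Rightarrow> 'a list \<Rightarrow> 's set" where
  "ws R p s = {q. weak R p s q \<and> \<not> enabled R q Tau}"

definition ready :: "('s, 'a) lts \<Rightarrow> 's \<Rightarrow> 'a set" where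
  "ready R t = {\<mu>. enabled R t (Vis \<mu>)}"

definition coR :: "('a \<Rightarrow> 'a) \<Rightarrow> 'a set \<Rightarrow> ('s, 'a) lts \<Rightarrow> 's \<Rightarrow> 'a set" where
  "coR dual N R p = {\<beta> \<in> - N. enabled R p (Vis (dual \<beta>))}"

text \<open>The values of \<open>\<phi>\<close> outside \<open>- N\<close> and of \<open>\<delta>\<close> outside \<open>Y\<close> are irrelevant.\<close>

definition label_abstraction ::
    "'a set \<Rightarrow> 'y set \<Rightarrow> 'x set \<Rightarrow> ('a \<Rightarrow> 'y) \<Rightarrow> ('y \<Rightarrow> 'x) \<Rightarrow> bool" where
  "label_abstraction N Y X \<phi> \<delta> \<longleftrightarrow> \<phi> \<in> - N \<rightarrow> Y \<and> \<delta> \<in> Y \<rightarrow> X"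

definition coR_abs ::
    "('a \<Rightarrow> 'a) \<Rightarrow> 'a set \<Rightarrow> ('s, 'a) lts \<Rightarrow> ('a \<Rightarrow> 'y) \<Rightarrow> ('y \<Rightarrow> 'x) \<Rightarrow> 's \<Rightarrow> 'x set" where
  "coR_abs dual N R \<phi> \<delta> p = (\<lambda>\<beta>. \<delta> (\<phi> \<beta>)) ` coR dual N R p"

definition finitary ::
    "('a \<Rightarrow> 'a) \<Rightarrow> 'a set \<Rightarrow> ('s, 'a) lts \<Rightarrow> ('a \<Rightarrow> 'y) \<Rightarrow> ('y \<Rightarrow> 'x) \<Rightarrow> bool" where
  "finitary dual N R \<phi> \<delta> \<longleftrightarrow> (\<forall>p. finite (coR_abs dual N R \<phi> \<delta> p))"

definition abstracts ::
    "('a \<Rightarrow> 'a) \<Rightarrow> 'a set \<Rightarrow> ('a \<Rightarrow> 'y) \<Rightarrow> ('y \<Rightarrow> 'x) \<Rightarrow> ('p, 'a) lts \<Rightarrow> ('t, 'a) lts \<Rightarrow> bool" where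
  "abstracts dual N \<phi> \<delta> L T \<longleftrightarrow> (\<forall>\<beta>\<in>- N. \<forall>\<beta>'\<in>- N.
     (\<forall>t. \<phi> \<beta> = \<phi> \<beta>' \<longrightarrow> \<beta> \<in> ready T t \<longrightarrow> \<beta>' \<in> ready T t) \<and>
     (\<forall>p. \<delta> (\<phi> \<beta>) = \<delta> (\<phi> \<beta>') \<longrightarrow> \<phi> \<beta> \<in> \<phi> ` coR dual N L p \<longrightarrow> \<phi> \<beta>' \<in> \<phi> ` coR dual N L p))"

definition acc_sets ::
    "('a \<Rightarrow> 'a) \<Rightarrow> 'a set \<Rightarrow> ('s, 'a) lts \<Rightarrow> ('a \<Rightarrow> 'y) \<Rightarrow> ('y \<Rightarrow> 'x) \<Rightarrow> 's \<Rightarrow> 'a list \<Rightarrow> 'x set set"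
  where "acc_sets dual N R \<phi> \<delta> p s = coR_abs dual N R \<phi> \<delta> ` ws R p s"

definition acc_le :: "'x set set \<Rightarrow> 'x set set \<Rightarrow> bool" where
  "acc_le U V \<longleftrightarrow> (\<forall>x\<in>V. \<exists>y\<in>U. y \<subseteq> x)"

definition abs_preorder ::
    "('a \<Rightarrow> 'a) \<Rightarrow> 'a set \<Rightarrow> ('s, 'a) lts \<Rightarrow> ('a \<Rightarrow> 'y) \<Rightarrow> ('y \<Rightarrow> 'x) \<Rightarrow> 's \<Rightarrow> 's \<Rightarrow> bool" where
  "abs_preorder dual N R \<phi> \<delta> p q \<longleftrightarrow> (\<forall>s. converges_along R p s \<longrightarrow>
     converges_along R q s \<and> acc_le (acc_sets dual N R \<phi> \<delta> p s) (acc_sets dual N R \<phi> \<delta> q s))"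

subsection \<open>Test generators for completeness\<close>

definition trace_following ::
    "'a set \<Rightarrow> ('t, 'a) lts \<Rightarrow> ('t \<Rightarrow> bool) \<Rightarrow> ('a list \<Rightarrow> 't) \<Rightarrow> bool" where
  "trace_following N T good f \<longleftrightarrow> (\<forall>s.
     \<not> good (f s) \<and>
     (\<forall>\<mu>. T (f (\<mu> # s)) (Vis \<mu>) (f s)) \<and>
     (\<forall>\<mu>\<in>- N. enabled T (f (\<mu> # s)) Tau) \<and>
     (\<forall>\<mu>\<in>- N. \<forall>t. T (f (\<mu> # s)) Tau t \<longrightarrow> good t) \<and>
     (\<forall>\<mu>\<in>- N. \<forall>t. T (f (\<mu> # s)) (Vis \<mu>) t \<longrightarrow> t = f s) \<and>
     (\<forall>\<mu>\<in>- N. \<forall>\<mu>' t. T (f (\<mu> # s)) (Vis \<mu>') t \<longrightarrow> \<mu>' \<noteq> \<mu> \<longrightarrow> good t))"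

definition AxCmpl ::
    "'a set \<Rightarrow> ('t, 'a) lts \<Rightarrow> ('t \<Rightarrow> bool) \<Rightarrow> 'x set \<Rightarrow> ('a \<Rightarrow> 'y) \<Rightarrow> ('y \<Rightarrow> 'x) \<Rightarrow> bool" where
  "AxCmpl N T good X \<phi> \<delta> \<longleftrightarrow> (\<exists>(tcnv :: 'a list \<Rightarrow> 't) (tacc :: 'a list \<Rightarrow> 'x set \<Rightarrow> 't).
     trace_following N T good tcnv \<and>
     (\<forall>E. finite E \<longrightarrow> E \<subseteq> X \<longrightarrow>
        trace_following N T good (\<lambda>s. tacc s E) \<and>
        \<not> enabled T (tacc [] E) Tau \<and>
        (\<forall>\<eta>\<in>N. \<not> enabled T (tacc [] E) (Vis \<eta>)) \<and>
        (\<forall>\<beta>\<in>- N. enabled T (tacc [] E) (Vis \<beta>) \<longrightarrow> \<delta> (\<phi> \<beta>) \<in> E) \<and>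
        (\<forall>e\<in>E. \<exists>\<beta>\<in>- N. e = \<delta> (\<phi> \<beta>) \<and> enabled T (tacc [] E) (Vis \<beta>)) \<and>
        (\<forall>\<beta>\<in>- N. \<forall>t. T (tacc [] E) (Vis \<beta>) t \<longrightarrow> good t)) \<and>
     (\<forall>\<mu>. \<not> enabled T (tcnv []) (Vis \<mu>)) \<and>
     enabled T (tcnv []) Tau \<and>
     (\<forall>t. T (tcnv []) Tau t \<longrightarrow> good t))"

end

theory Submission
  imports Defs
begin

text \<open>
  A process \<open>p\<close> is run against the test \<open>f (map dual s)\<close>, where \<open>f\<close> is one of the two test
  generators. If \<open>p\<close> diverges along \<open>s\<close>, or reaches along \<open>s\<close> a stable state that cannot synchronise
  with \<open>E\<close>, then test and process can walk along \<open>s\<close> through states that are not good, so \<open>Must\<close>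
  fails. Conversely, if \<open>p\<close> converges along \<open>s\<close>, passing \<open>f []\<close> after \<open>s\<close> suffices for passing
  \<open>f (map dual s)\<close>: a blocking head of the trace is handled by induction on the silent steps of \<open>p\<close>,
  while a non-blocking head \<open>\<eta>\<close> can be moved from the test into the process. Given a stable
  derivative \<open>q'\<close> of \<open>q\<close>, the set \<open>E\<close> collects what the finitely many stable derivatives of \<open>p\<close> offer
  beyond \<open>q'\<close>.
\<close>

section \<open>Convergence and finiteness of weak derivatives\<close>

text \<open>A failure of \<open>P\<close> at a state forces a failure at some silent successor, so a
  failure at \<open>p\<close> could be iterated into an infinite silent computation.\<close>

lemma not_diverges_induct [consumes 1, case_names step]:
  assumes "\<not> diverges R p"
    and step: "\<And>p. (\<And>p'. R p Tau p' \<Longrightarrow> P p') \<Longrightarrow> P p"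
  shows "P p"
proof (rule ccontr)
  assume "\<not> P p"
  have next_ex: "\<exists>y. \<not> P y \<and> R x Tau y" if "\<not> P x" for x
    using step that by blast
  \<comment> \<open>The clause on \<open>n = 0\<close> pins the chosen sequence to start at
    \<open>p\<close>.\<close>
  obtain c where "\<And>n. \<not> P (c n) \<and> (n = 0 \<longrightarrow> c n = p)" "\<And>n. R (c n) Tau (c (Suc n))"
    using dependent_nat_choice[of "\<lambda>n x. \<not> P x \<and> (n = 0 \<longrightarrow> x = p)" "\<lambda>_ x y. R x Tau y"]
      \<open>\<not> P p\<close> next_ex by (metis nat.distinct(1))
  then have "infinite_computation (\<lambda>x y. R x Tau y) p c"
    by (simp add: infinite_computation_def)
  then show False
    using assms(1) by (auto simp: diverges_def)
qed

lemma converges_along_not_diverges: "converges_along R p s \<Longrightarrow> \<not> diverges R p"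
  unfolding converges_along_def by (metis Nil_prefix weak_refl)

lemma converges_along_tau: "converges_along R p s \<Longrightarrow> R p Tau p' \<Longrightarrow> converges_along R p' s"
  unfolding converges_along_def by (blast intro: weak_tau)

lemma converges_along_vis:
  "converges_along R p (\<mu> # s) \<Longrightarrow> R p (Vis \<mu>) p' \<Longrightarrow> converges_along R p' s"
  unfolding converges_along_def by (metis Cons_prefix_Cons weak_vis)

text \<open>Splitting off the first transition yields a finite union, by
  \<open>finite_image\<close>. Each visible transition shortens the trace and convergence rules out
  endless silent ones, hence an induction on silent steps nested in one on \<open>s\<close>.\<close>

lemma finite_weak_derivatives:
  assumes fin: "finite_image R" and "converges_along R p s"
  shows "finite {q. weak R p s q}"
  using assms(2)
proof (induction s arbitrary: p)
  case Nil
  from converges_along_not_diverges[OF Nil] Nil show ?case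
  proof (induction rule: not_diverges_induct)
    case (step p)
    have "{q. weak R p [] q} = insert p (\<Union>p'\<in>{p'. R p Tau p'}. {q. weak R p' [] q})"
      by (auto intro: weak.intros elim: weak.cases)
    moreover have "finite {p'. R p Tau p'}"
      using fin by (simp add: finite_image_def)
    ultimately show ?case
      using step converges_along_tau by fastforce
  qed
next
  case (Cons \<mu> s)
  from converges_along_not_diverges[OF Cons.prems] Cons.prems show ?case
  proof (induction rule: not_diverges_induct)
    case (step p)
    have "{q. weak R p (\<mu> # s) q} = (\<Union>p'\<in>{p'. R p Tau p'}. {q. weak R p' (\<mu> # s) q})
        \<union> (\<Union>p'\<in>{p'. R p (Vis \<mu>) p'}. {q. weak R p' s q})"
      by (auto intro: weak.intros elim: weak.cases)
    moreover have "finite {p'. R p \<alpha> p'}" for \<alpha>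
      using fin by (simp add: finite_image_def)
    moreover have "finite {q. weak R p' (\<mu> # s) q}" if "R p Tau p'" for p'
      using step that converges_along_tau by fastforce
    moreover have "finite {q. weak R p' s q}" if "R p (Vis \<mu>) p'" for p'
      using Cons.IH step.prems that converges_along_vis by fastforce
    ultimately show ?case by simp
  qed
qed

section \<open>Passing a test as a least fixed point\<close>

text \<open>This form allows \<open>Must\<close> to be proved by induction. The witness
  \<open>y\<close> in \<open>later\<close> keeps a stuck pair whose test is not good from passing
  vacuously.\<close>

inductive must_ind ::
    "('a \<Rightarrow> 'a) \<Rightarrow> ('p, 'a) lts \<Rightarrow> ('t, 'a) lts \<Rightarrow> ('t \<Rightarrow> bool) \<Rightarrow> 'p \<times> 't \<Rightarrow> bool"
  for dual L T good where
  now: "good (snd x) \<Longrightarrow> must_ind dual L T good x"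
| later: "comp_step dual L T x y \<Longrightarrow>
    (\<And>z. comp_step dual L T x z \<Longrightarrow> must_ind dual L T good z) \<Longrightarrow> must_ind dual L T good x"

lemma must_ind_finite:
  assumes "must_ind dual L T good x" "finite_maximal_computation (comp_step dual L T) x xs"
  shows "\<exists>y\<in>set xs. good (snd y)"
  using assms
proof (induction arbitrary: xs)
  case (now x)
  then show ?case
    by (metis finite_maximal_computation_def list.set_sel(1))
next
  case (later x y)
  then obtain ys where xs: "xs = x # ys"
    by (metis finite_maximal_computation_def list.collapse)
  with later.hyps(1) later.prems have "ys \<noteq> []"
    unfolding finite_maximal_computation_def by (metis last.simps)
  with later.prems xs have "comp_step dual L T x (hd ys)"
      "finite_maximal_computation (comp_step dual L T) (hd ys) ys"
    by (auto simp: finite_maximal_computation_def successively_Cons)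
  with later.IH xs show ?case by auto
qed

lemma must_ind_infinite:
  assumes "must_ind dual L T good x" "infinite_computation (comp_step dual L T) x c"
  shows "\<exists>i. good (snd (c i))"
  using assms
proof (induction arbitrary: c)
  case (now x)
  then show ?case
    by (metis infinite_computation_def)
next
  case (later x y)
  then have "comp_step dual L T x (c 1)"
      "infinite_computation (comp_step dual L T) (c 1) (\<lambda>i. c (Suc i))"
    by (auto simp: infinite_computation_def)
  with later.IH show ?case by blast
qed

lemma must_ind_imp_Must: "must_ind dual L T good (p, t) \<Longrightarrow> Must dual L T good p t"
  unfolding Must_def using must_ind_finite must_ind_infinite by blast

section \<open>Consequences of passing a test\<close>

text \<open>A maximal computation of the successor extends backwards to one of
  \<open>(p, t)\<close>; as \<open>t\<close> is not good, the good test lies in the tail.\<close>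

lemma Must_step:
  assumes M: "Must dual L T good p t" and "\<not> good t" and step: "comp_step dual L T (p, t) (p', t')"
  shows "Must dual L T good p' t'"
  unfolding Must_def
proof (intro conjI allI impI)
  fix xs assume "finite_maximal_computation (comp_step dual L T) (p', t') xs"
  with step have "finite_maximal_computation (comp_step dual L T) (p, t) ((p, t) # xs)"
    by (auto simp: finite_maximal_computation_def successively_Cons)
  with M \<open>\<not> good t\<close> show "\<exists>x\<in>set xs. good (snd x)"
    unfolding Must_def by fastforce
next
  fix c assume "infinite_computation (comp_step dual L T) (p', t') c"
  with step have "infinite_computation (comp_step dual L T) (p, t) (case_nat (p, t) c)"
    by (auto simp: infinite_computation_def split: nat.split)
  with M obtain i where "good (snd (case_nat (p, t) c i))"
    unfolding Must_def by blast
  with \<open>\<not> good t\<close> show "\<exists>i. good (snd (c i))"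
    by (cases i) auto
qed

text \<open>No test \<open>f s\<close> is good, so \<open>Must\<close> survives each step while the
  test reads off the trace. The trace is dualised because \<open>comm\<close> pairs
  \<open>\<mu>\<close> of the test with \<open>dual \<mu>\<close> of the process.\<close>

lemma Must_weak:
  assumes "involutive dual" "trace_following N T good f"
    and "weak L p s q" "Must dual L T good p (f (map dual s @ u))"
  shows "Must dual L T good q (f u)"
  using assms(3,4)
proof (induction)
  case (weak_refl p)
  then show ?case by simp
next
  case (weak_tau p p' s q)
  have "\<not> good (f (map dual s @ u))"
    using assms(2) by (simp add: trace_following_def)
  then have "Must dual L T good p' (f (map dual s @ u))"
    using Must_step[OF weak_tau.prems _ comp_step.proc_tau] weak_tau.hyps(1) by blast
  then show ?case
    by (rule weak_tau.IH)
next
  case (weak_vis p \<mu> p' s q)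
  have "\<not> good (f (map dual (\<mu> # s) @ u))"
    "T (f (map dual (\<mu> # s) @ u)) (Vis (dual \<mu>)) (f (map dual s @ u))"
    using assms(2) by (simp_all add: trace_following_def)
  moreover have "L p (Vis (dual (dual \<mu>))) p'"
    using assms(1) weak_vis.hyps by (simp add: involutive_def)
  ultimately have "Must dual L T good p' (f (map dual s @ u))"
    using Must_step[OF weak_vis.prems _ comp_step.comm] by blast
  then show ?case
    by (rule weak_vis.IH)
qed

text \<open>With the test idle, an infinite silent run of the process would never show a good
  test.\<close>

lemma Must_not_diverges:
  assumes "Must dual L T good p t" "\<not> good t"
  shows "\<not> diverges L p"
proof
  assume "diverges L p"
  then obtain c where "infinite_computation (\<lambda>x y. L x Tau y) p c"
    by (auto simp: diverges_def)
  then have "infinite_computation (comp_step dual L T) (p, t) (\<lambda>i. (c i, t))"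
    by (auto simp: infinite_computation_def intro: comp_step.proc_tau)
  with assms show False
    unfolding Must_def by fastforce
qed

lemma Must_converges_along:
  assumes "involutive dual" "trace_following N T good f"
    and "Must dual L T good p (f (map dual s))"
  shows "converges_along L p s"
  unfolding converges_along_def
proof (intro allI impI)
  fix s' q assume "prefix s' s" "weak L p s' q"
  moreover from this obtain u where "s = s' @ u"
    by (auto simp: prefix_def)
  ultimately have "Must dual L T good q (f (map dual u))"
    using Must_weak[OF assms(1,2), of L p s' q "map dual u"] assms(3) by simp
  then show "\<not> diverges L q"
    by (rule Must_not_diverges) (use assms(2) in \<open>simp add: trace_following_def\<close>)
qed

lemma Must_not_stuck:
  assumes "Must dual L T good p t" "\<not> good t"
  shows "\<exists>y. comp_step dual L T (p, t) y"
  using assms by (force simp: Must_def finite_maximal_computation_def dest: spec[of _ "[(p, t)]"])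

section \<open>Sufficient conditions for passing the generated tests\<close>

text \<open>A pending non-blocking \<open>\<eta>\<close> may be moved from the process into the test.\<close>

lemma must_ind_swap:
  assumes inv: "involutive dual" and L: "in_M dual N L" and T: "in_A dual N T"
    and good: "good_N_invariant N T good" and \<eta>: "\<eta> \<in> N"
    and "must_ind dual L T good (p', t')" "L p' (Vis \<eta>) p" "T t (Vis \<eta>) t'"
  shows "must_ind dual L T good (p, t)"
  using assms(6-8)
proof (induction "(p', t')" arbitrary: p' t' p t)
  case now
  then show ?case
    using good \<eta> by (auto simp: good_N_invariant_def intro: must_ind.now)
next
  case (later y)
  note succ = later.hyps(2) and p' = \<open>L p' (Vis \<eta>) p\<close> and t = \<open>T t (Vis \<eta>) t'\<close>
  have IH: "must_ind dual L T good (r, u)"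
    if "comp_step dual L T (p', t') (a, b)" "L a (Vis \<eta>) r" "T u (Vis \<eta>) b" for a b r u
    using later.hyps(3) that by blast
  \<comment> \<open>\<open>Boomerang\<close> ensures that \<open>(p, t)\<close> is not stuck, as
    \<open>later\<close> requires.\<close>
  obtain r where "L p (Vis (dual \<eta>)) r"
    using L \<eta> unfolding in_M_def Boomerang_def by blast
  then have "comp_step dual L T (p, t) (r, t')"
    using t by (rule comp_step.comm)
  then show ?case
  proof (rule must_ind.later)
    fix z assume "comp_step dual L T (p, t) z"
    then show "must_ind dual L T good z"
    proof (cases rule: comp_step.cases)
      case (proc_tau p1)
      then obtain p4 where "L p' Tau p4" "L p4 (Vis \<eta>) p1"
        using L \<eta> p' unfolding in_M_def N_delay_def by blast
      then show ?thesis
        using IH[OF comp_step.proc_tau] proc_tau t by simp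
    next
      case (test_tau t1)
      then consider t4 where "T t' Tau t4" "T t1 (Vis \<eta>) t4" | "T t' (Vis (dual \<eta>)) t1"
        using T \<eta> t unfolding in_A_def N_tau_def by blast
      then show ?thesis
      proof cases
        case 1
        then show ?thesis
          using IH[OF comp_step.test_tau] test_tau p' by simp
      next
        \<comment> \<open>The pair \<open>(p, t1)\<close> is also a successor of
          \<open>(p', t')\<close>, by a communication of \<open>\<eta>\<close> from
          \<open>p'\<close> with \<open>dual \<eta>\<close> from \<open>t'\<close>.\<close>
        case 2
        have "L p' (Vis (dual (dual \<eta>))) p"
          using p' inv by (simp add: involutive_def)
        with 2 show ?thesis
          using succ[OF comp_step.comm] test_tau by blast
      qed
    next
      case (comm \<mu> p1 t1)
      show ?thesis
      proof (cases "\<mu> = \<eta>")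
        \<comment> \<open>By feedback the new pair is \<open>(p', t')\<close> itself or a silent
          successor of it.\<close>
        case True
        then have "t1 = t'"
          using T \<eta> t comm unfolding in_A_def N_determinacy_def by blast
        moreover have "L p' Tau p1 \<or> p' = p1"
          using L \<eta> p' comm True unfolding in_M_def Fwd_Feedback_def by blast
        ultimately show ?thesis
          using comm succ[OF comp_step.proc_tau] must_ind.later[OF later.hyps(1) succ] by blast
      next
        case False
        then obtain t4 where "T t' (Vis \<mu>) t4" "T t1 (Vis \<eta>) t4"
          using T \<eta> t comm unfolding in_A_def N_confluence_def by blast
        moreover obtain p4 where "L p' (Vis (dual \<mu>)) p4" "L p4 (Vis \<eta>) p1"
          using L \<eta> p' comm unfolding in_M_def N_delay_def by blast
        ultimately show ?thesis
          using IH[OF comp_step.comm] comm by simp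
      qed
    qed
  qed
qed

lemma must_ind_trace_following:
  assumes inv: "involutive dual" and L: "in_M dual N L" and T: "in_A dual N T"
    and good: "good_N_invariant N T good" and f: "trace_following N T good f"
    and "converges_along L p s" "\<And>q. weak L p s q \<Longrightarrow> must_ind dual L T good (q, f [])"
  shows "must_ind dual L T good (p, f (map dual s))"
  using assms(6,7)
proof (induction s arbitrary: p)
  case Nil
  then show ?case by (simp add: weak_refl)
next
  case (Cons \<mu> s)
  have dd: "dual (dual \<nu>) = \<nu>" for \<nu>
    using inv by (simp add: involutive_def)
  \<comment> \<open>Kept general in the process, which changes by silent steps in the blocking
    case.\<close>
  have IH: "must_ind dual L T good (p', f (map dual s))"
    if "L p (Vis \<mu>) p'" "converges_along L p (\<mu> # s)"
      "\<And>q. weak L p (\<mu> # s) q \<Longrightarrow> must_ind dual L T good (q, f [])" for p p'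
    using Cons.IH[OF converges_along_vis[OF that(2,1)]] weak_vis[where R = L, OF that(1)] that(3)
    by blast
  show ?case
  proof (cases "dual \<mu> \<in> N")
    \<comment> \<open>By \<open>Boomerang\<close>, \<open>p\<close> can perform \<open>\<mu>\<close>
      and return by \<open>dual \<mu>\<close>. The intermediate state passes the rest of the test by
      \<open>IH\<close>, and \<open>must_ind_swap\<close> hands the pending
      \<open>dual \<mu>\<close> to the test.\<close>
    case True
    then obtain p' where p': "L p (Vis \<mu>) p'" "L p' (Vis (dual \<mu>)) p"
      using L dd unfolding in_M_def Boomerang_def by metis
    have "T (f (dual \<mu> # map dual s)) (Vis (dual \<mu>)) (f (map dual s))"
      using f by (simp add: trace_following_def)
    with must_ind_swap[OF inv L T good True IH[OF p'(1) Cons.prems] p'(2)] show ?thesis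
      by simp
  next
    \<comment> \<open>Only silent steps of the process and the communication on
      \<open>dual \<mu>\<close> need not reach a good test; the inner induction treats the former,
      \<open>IH\<close> the latter.\<close>
    case False
    then have en: "enabled T (f (dual \<mu> # map dual s)) Tau"
      and tau: "\<And>t. T (f (dual \<mu> # map dual s)) Tau t \<Longrightarrow> good t"
      and vis: "\<And>t. T (f (dual \<mu> # map dual s)) (Vis (dual \<mu>)) t \<Longrightarrow> t = f (map dual s)"
      and oth: "\<And>\<nu> t. T (f (dual \<mu> # map dual s)) (Vis \<nu>) t \<Longrightarrow> \<nu> \<noteq> dual \<mu> \<Longrightarrow> good t"
      using f unfolding trace_following_def by blast+
    from converges_along_not_diverges[OF Cons.prems(1)] Cons.prems show ?thesis
    proof (induction rule: not_diverges_induct)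
      case (step p)
      obtain t where "T (f (dual \<mu> # map dual s)) Tau t"
        using en by (auto simp: enabled_def)
      then have "comp_step dual L T (p, f (dual \<mu> # map dual s)) (p, t)"
        by (rule comp_step.test_tau)
      then show ?case
        unfolding list.map
      proof (rule must_ind.later)
        fix z assume "comp_step dual L T (p, f (dual \<mu> # map dual s)) z"
        then show "must_ind dual L T good z"
        proof (cases rule: comp_step.cases)
          case (proc_tau p1)
          then have "must_ind dual L T good (p1, f (map dual (\<mu> # s)))"
            using step.IH[OF _ converges_along_tau[OF step.prems(1)]] step.prems(2)
              weak_tau[where R = L] by blast
          then show ?thesis using proc_tau by simp
        next
          case (test_tau t1)
          then show ?thesis
            using tau by (auto intro: must_ind.now)
        next
          case (comm \<nu> p1 t1)
          show ?thesis
          proof (cases "\<nu> = dual \<mu>")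
            case True
            then show ?thesis
              using comm vis IH[OF _ step.prems] dd by metis
          next
            case False
            then show ?thesis
              using comm oth by (auto intro: must_ind.now)
          qed
        qed
      qed
    qed
  qed
qed

text \<open>The silent step of the test is always available and leads to a good test; without
  communications, only finitely many silent steps of \<open>p\<close> can precede it.\<close>

lemma must_ind_convergence_test:
  assumes "\<not> diverges L p" "\<And>\<mu>. \<not> enabled T t (Vis \<mu>)" "enabled T t Tau"
    and "\<And>t'. T t Tau t' \<Longrightarrow> good t'"
  shows "must_ind dual L T good (p, t)"
  using assms(1)
proof (induction rule: not_diverges_induct)
  case (step p)
  obtain t' where "T t Tau t'"
    using assms(3) by (auto simp: enabled_def)
  then have "comp_step dual L T (p, t) (p, t')"
    by (rule comp_step.test_tau)
  then show ?case
  proof (rule must_ind.later)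
    fix z assume "comp_step dual L T (p, t) z"
    then show "must_ind dual L T good z"
      using step assms(2,4)
      by (cases rule: comp_step.cases) (auto simp: enabled_def intro: must_ind.now)
  qed
qed

text \<open>Every communication makes the test good, so it suffices that no stable derivative of
  \<open>p\<close> is stuck; meeting \<open>E\<close> ensures this.\<close>

lemma must_ind_acceptance_test:
  assumes abs: "abstracts dual N \<phi> \<delta> L T"
    and no_tau: "\<not> enabled T t Tau"
    and no_N: "\<And>\<eta>. \<eta> \<in> N \<Longrightarrow> \<not> enabled T t (Vis \<eta>)"
    and offers: "\<And>e. e \<in> E \<Longrightarrow> \<exists>\<beta>\<in>- N. e = \<delta> (\<phi> \<beta>) \<and> enabled T t (Vis \<beta>)"
    and good: "\<And>\<beta> t'. \<beta> \<notin> N \<Longrightarrow> T t (Vis \<beta>) t' \<Longrightarrow> good t'"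
    and "\<not> diverges L p" "\<And>q. q \<in> ws L p [] \<Longrightarrow> coR_abs dual N L \<phi> \<delta> q \<inter> E \<noteq> {}"
  shows "must_ind dual L T good (p, t)"
  using assms(6,7)
proof (induction rule: not_diverges_induct)
  case (step p)
  have tau: "must_ind dual L T good (p', t)" if "L p Tau p'" for p'
    using that step.IH step.prems unfolding ws_def by (blast intro: weak_tau)
  have "\<exists>y. comp_step dual L T (p, t) y"
  proof (cases "enabled L p Tau")
    case True
    then show ?thesis
      by (auto simp: enabled_def intro: comp_step.proc_tau)
  next
    case False
    \<comment> \<open>The test offers some \<open>\<beta>'\<close> with the same abstract value as
      \<open>\<beta>\<close>. Abstraction on processes gives a \<open>\<beta>''\<close> available to
      \<open>p\<close> with the \<open>\<phi>\<close>-value of \<open>\<beta>'\<close>, and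
      abstraction on tests makes the test ready for \<open>\<beta>''\<close>.\<close>
    then obtain \<beta> where \<beta>: "\<beta> \<in> coR dual N L p" "\<delta> (\<phi> \<beta>) \<in> E"
      using step.prems[of p] by (auto simp: ws_def coR_abs_def intro: weak_refl)
    then obtain \<beta>' where \<beta>': "\<beta>' \<in> - N" "\<delta> (\<phi> \<beta>) = \<delta> (\<phi> \<beta>')" "\<beta>' \<in> ready T t"
      using offers by (auto simp: ready_def)
    moreover have "\<beta> \<in> - N"
      using \<beta>(1) by (simp add: coR_def)
    ultimately have "\<phi> \<beta>' \<in> \<phi> ` coR dual N L p"
      using abs \<beta>(1) unfolding abstracts_def by blast
    then obtain \<beta>'' where "\<beta>'' \<in> coR dual N L p" "\<phi> \<beta>' = \<phi> \<beta>''"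
      by blast
    moreover from this have "\<beta>'' \<in> ready T t"
      using abs \<beta>' unfolding abstracts_def coR_def by blast
    ultimately show ?thesis
      unfolding coR_def ready_def enabled_def by (blast intro: comp_step.comm)
  qed
  then obtain y where "comp_step dual L T (p, t) y" by blast
  then show ?case
  proof (rule must_ind.later)
    fix z assume "comp_step dual L T (p, t) z"
    then show "must_ind dual L T good z"
    proof (cases rule: comp_step.cases)
      case (comm \<mu> p1 t1)
      then have "good t1"
        using no_N good unfolding enabled_def by blast
      then show ?thesis
        using comm by (auto intro: must_ind.now)
    qed (use tau no_tau in \<open>auto simp: enabled_def\<close>)
  qed
qed

section \<open>Comparing convergence and acceptance sets of the two processes\<close>

lemma ws_weak: "weak R p s q \<Longrightarrow> ws R q [] \<subseteq> ws R p s"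
proof (induction rule: weak.induct)
  case (weak_tau p p' s q)
  then show ?case
    unfolding ws_def by (blast intro: weak.weak_tau)
next
  case (weak_vis p \<mu> p' s q)
  then show ?case
    unfolding ws_def by (blast intro: weak.weak_vis)
qed simp

theorem proposition25:
  fixes dual :: "'a::countable \<Rightarrow> 'a"
    and N :: "'a set"
    and L :: "('p, 'a) lts"
    and T :: "('t, 'a) lts"
    and good :: "'t \<Rightarrow> bool"
    and Y :: "'y set" and X :: "'x set"
    and \<phi> :: "'a \<Rightarrow> 'y" and \<delta> :: "'y \<Rightarrow> 'x"
    and p q :: 'p
  assumes "involutive dual"
    and "finite_image L" and "finite_image T"
    and "in_M dual N L" and "in_A dual N T"
    and "good_N_invariant N T good"
    and "label_abstraction N Y X \<phi> \<delta>"
    and "abstracts dual N \<phi> \<delta> L T"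
    and "AxCmpl N T good X \<phi> \<delta>"
    and "finitary dual N L \<phi> \<delta>"
    and "must_preorder dual L T good p q"
  shows "abs_preorder dual N L \<phi> \<delta> p q"
proof -
  obtain tcnv tacc where cnv: "trace_following N T good tcnv"
    and cnv_nil: "\<forall>\<mu>. \<not> enabled T (tcnv []) (Vis \<mu>)" "enabled T (tcnv []) Tau"
      "\<forall>t. T (tcnv []) Tau t \<longrightarrow> good t"
    and acc_all: "\<forall>E. finite E \<longrightarrow> E \<subseteq> X \<longrightarrow> trace_following N T good (\<lambda>s. tacc s E) \<and>
      \<not> enabled T (tacc [] E) Tau \<and>
      (\<forall>\<eta>\<in>N. \<not> enabled T (tacc [] E) (Vis \<eta>)) \<and>
      (\<forall>\<beta>\<in>- N. enabled T (tacc [] E) (Vis \<beta>) \<longrightarrow> \<delta> (\<phi> \<beta>) \<in> E) \<and>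
      (\<forall>e\<in>E. \<exists>\<beta>\<in>- N. e = \<delta> (\<phi> \<beta>) \<and> enabled T (tacc [] E) (Vis \<beta>)) \<and>
      (\<forall>\<beta>\<in>- N. \<forall>t. T (tacc [] E) (Vis \<beta>) t \<longrightarrow> good t)"
    using assms(9) unfolding AxCmpl_def by (elim exE conjE) (rule that)
  note trace = must_ind_trace_following[OF assms(1,4,5,6)]
  let ?A = "coR_abs dual N L \<phi> \<delta>"
  have after: "\<not> diverges L r" if "converges_along L p s" "weak L p s r" for s r
    using that unfolding converges_along_def by (metis prefix_order.refl)
  have transfer: "Must dual L T good q t" if "must_ind dual L T good (p, t)" for t
    using assms(11) must_ind_imp_Must[OF that] by (simp add: must_preorder_def)
  have conv: "converges_along L q s" if "converges_along L p s" for s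
  proof -
    have "must_ind dual L T good (p, tcnv (map dual s))"
      by (intro trace[OF cnv that] must_ind_convergence_test after[OF that]) (use cnv_nil in auto)
    then have "Must dual L T good q (tcnv (map dual s))"
      by (rule transfer)
    then show ?thesis
      by (rule Must_converges_along[OF assms(1) cnv])
  qed
  have acc: "\<exists>p'\<in>ws L p s. ?A p' \<subseteq> ?A q'"
    if s: "converges_along L p s" and q': "q' \<in> ws L q s" for s q'
  proof (rule ccontr)
    assume none: "\<not> ?thesis"
    define E where "E = (\<Union>p'\<in>ws L p s. ?A p' - ?A q')"
    \<comment> \<open>\<open>tacc\<close> is only specified for finite subsets of
      \<open>X\<close>.\<close>
    have "finite (ws L p s)"
      using finite_weak_derivatives[OF assms(2) s] by (rule finite_subset[rotated]) (auto simp: ws_def)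
    then have "finite E"
      using assms(10) by (auto simp: E_def finitary_def)
    moreover have "E \<subseteq> X"
      using assms(7) by (auto simp: E_def coR_abs_def coR_def label_abstraction_def)
    ultimately have acc: "trace_following N T good (\<lambda>s. tacc s E)"
      and no_tau: "\<not> enabled T (tacc [] E) Tau"
      and no_N: "\<And>\<eta>. \<eta> \<in> N \<Longrightarrow> \<not> enabled T (tacc [] E) (Vis \<eta>)"
      and in_E: "\<And>\<beta>. \<beta> \<notin> N \<Longrightarrow> enabled T (tacc [] E) (Vis \<beta>) \<Longrightarrow> \<delta> (\<phi> \<beta>) \<in> E"
      and offers: "\<And>e. e \<in> E \<Longrightarrow> \<exists>\<beta>\<in>- N. e = \<delta> (\<phi> \<beta>) \<and> enabled T (tacc [] E) (Vis \<beta>)"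
      and good: "\<And>\<beta> t. \<beta> \<notin> N \<Longrightarrow> T (tacc [] E) (Vis \<beta>) t \<Longrightarrow> good t"
      using acc_all[rule_format, of E] by auto
    \<comment> \<open>By \<open>none\<close>, each \<open>?A p'\<close> contributes an element
      outside \<open>?A q'\<close> to \<open>E\<close>.\<close>
    have meets: "?A p' \<inter> E \<noteq> {}" if "p' \<in> ws L p s" for p'
      using that none unfolding E_def by blast
    have "must_ind dual L T good (r, tacc [] E)" if "weak L p s r" for r
      using meets ws_weak[OF that]
      by (intro must_ind_acceptance_test[OF assms(8) no_tau no_N offers good after[OF s that]]) auto
    then have "must_ind dual L T good (p, tacc (map dual s) E)"
      by (rule trace[OF acc s])
    \<comment> \<open>The suffix \<open>[]\<close> plays the part of \<open>u\<close> in
      \<open>Must_weak\<close>.\<close>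
    then have "Must dual L T good q (tacc (map dual s @ []) E)"
      using transfer by simp
    moreover have "weak L q s q'"
      using q' by (simp add: ws_def)
    ultimately have "Must dual L T good q' (tacc [] E)"
      using Must_weak[OF assms(1) acc, of L q s q' "[]"] by simp
    moreover have "\<not> good (tacc [] E)"
      using acc by (simp add: trace_following_def)
    ultimately obtain y where "comp_step dual L T (q', tacc [] E) y"
      using Must_not_stuck[of dual L T good q' "tacc [] E"] by blast
    \<comment> \<open>Neither \<open>q'\<close> nor the test has a silent step, so only a
      communication remains; its abstract label would lie in \<open>E\<close> and in
      \<open>?A q'\<close>, which are disjoint.\<close>
    then show False
    proof (cases rule: comp_step.cases)
      case (comm \<mu> p1 t1)
      then have "\<mu> \<notin> N" "\<delta> (\<phi> \<mu>) \<in> E"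
        using no_N in_E unfolding enabled_def by blast+
      moreover have "\<delta> (\<phi> \<mu>) \<in> ?A q'"
        using comm \<open>\<mu> \<notin> N\<close> by (auto simp: coR_abs_def coR_def enabled_def)
      ultimately show False
        by (simp add: E_def)
    qed (use q' no_tau in \<open>auto simp: ws_def enabled_def\<close>)
  qed
  show ?thesis
    using conv acc by (auto simp: abs_preorder_def acc_le_def acc_sets_def)
qed

end
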